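(* For every positive integer $n$ and every integer $m\ge 0$ there exists $t\ge 0$ such that, after $t$ iterations of the cellular automaton CA1 started from input $n$, the following holds for all $0\le k\le m$: the states of the cells of row $k$ of the bottom layer that are not in the state $\mathtt{empty}$, read from left to right, are the ternary digits (most significant first, possibly preceded by leading zeros) of $T_1^k(n)$.
   Context: The map $T_1$ on positive integers is $T_1(n)=(3n+1)/2$ if $n$ is odd and $T_1(n)=n/2$ if $n$ is even; $T_1^k$ is its $k$-th iterate, with $T_1^0(n)=n$. Cellular automaton CA1. Cells are triples $(i,j,l)$ with row $i\in\{0,1,2,\dots\}$ (indexed top to bottom), column $j\in\mathbb{Z}$ (indexed from right to left, so $(i,j+1,l)$ is the left neighbour of $(i,j,l)$), and layer $l\in\{0,1\}$ ($0$ = bottom, $1$ = top). The state of $(i,j,l)$ at time $t$ is $s_{i,j,l}(t)$. Bottom-layer states are $\mathtt{0},\mathtt{1},\mathtt{2},\mathtt{empty}$; top-layer states are $\mathtt{odd\text{-}normal},\mathtt{odd\text{-}special},\mathtt{even},\mathtt{unknown\text{-}parity}$. Initialization. If $n=\sum_{r=0}^{N}3^r d_r$ with $d_r\in\{0,1,2\}$, $d_N\ne 0$, fix any $c_0\in\mathbb{Z}$ and put $s_{0,c_0+r,0}(0)=d_r$ for $0\le r\le N$. All other bottom-layer cells are $\mathtt{empty}$ and all top-layer cells are $\mathtt{unknown\text{-}parity}$. Evolution. All cells are updated simultaneously at each time step, except that the bottom-layer cells of row $0$ keep their initial states forever. Top layer, for a cell $(i,j,1)$ with $i\ge0$. Let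 $\ell=s_{i,j+1,1}(t)$ and $d=s_{i,j,0}(t)$. Then $s_{i,j,1}(t+1)$ is: (1) if $\ell=\mathtt{unknown\text{-}parity}$ and $d\in\{0,1,2\}$: $\mathtt{even}$ if $d\in\{0,2\}$, $\mathtt{odd\text{-}normal}$ if $d=1$; (2) if $\ell\in\{\mathtt{even},\mathtt{odd\text{-}normal}\}$ and $d\in\{0,1,2\}$: the sum modulo 2 of the parity $\ell$ and $d$, written as $\mathtt{even}$ or $\mathtt{odd\text{-}normal}$; (3) if $\ell=\mathtt{odd\text{-}normal}$ and $d=\mathtt{empty}$: $\mathtt{odd\text{-}special}$; (4) in all other cases: $\mathtt{unknown\text{-}parity}$. Bottom layer, for a cell $(i,j,0)$ with $i\ge1$. Let $a=s_{i-1,j,0}(t)$, $b=s_{i-1,j-1,0}(t)$, $c=s_{i,j-1,0}(t)$, $p=s_{i-1,j,1}(t)$, $q=s_{i-1,j-1,1}(t)$. Then $x=s_{i,j,0}(t+1)$ is: (1) if $a,b,c\in\{0,1,2\}$, $p,q\in\{\mathtt{even},\mathtt{odd\text{-}normal}\}$, and $2c+\varepsilon\equiv b\pmod 3$ for some (necessarily unique) $\varepsilon\in\{0,1\}$: the unique $x\in\{0,1,2\}$ with $2(3x+c)+\varepsilon\equiv 3a+b\pmod 9$; (2) if $a\in\{0,1,2\}$, $b=c=\mathtt{empty}$, $p=\mathtt{even}$, $q=\mathtt{unknown\text{-}parity}$: the unique $x\in\{0,1,2\}$ with $2x\equiv a\pmod 3$; (3) if $a=b=c=\mathtt{empty}$,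 $p=\mathtt{odd\text{-}special}$, $q=\mathtt{unknown\text{-}parity}$: $x=2$; (4) if $a\in\{0,1,2\}$, $b=\mathtt{empty}$, $c=2$, $p=\mathtt{odd\text{-}normal}$, $q=\mathtt{odd\text{-}special}$: the unique $x\in\{0,1,2\}$ with $2(3x+2)\equiv 3a+1\pmod 9$; (5) in all other cases: $\mathtt{empty}$. *)

theory Defs
  imports "HOL-Number_Theory.Cong"
begin

definition T1 :: "nat \<Rightarrow> nat" where
  "T1 n = (if odd n then (3 * n + 1) div 2 else n div 2)"

datatype trit = Zero | One | Two

fun trit_val :: "trit \<Rightarrow> nat" where
  "trit_val Zero = 0"
| "trit_val One = 1"
| "trit_val Two = 2"

definition trit_of :: "nat \<Rightarrow> trit" where
  "trit_of n = (if n mod 3 = 0 then Zero else if n mod 3 = 1 then One else Two)"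

text \<open>Base-3 digits, least significant first and without leading zeros.\<close>

fun ternary_digits :: "nat \<Rightarrow> trit list" where
  "ternary_digits n = (if n = 0 then [] else trit_of n # ternary_digits (n div 3))"

declare ternary_digits.simps [simp del]

lemma trit_val_trit_of: "trit_val (trit_of n) = n mod 3"
  by (auto simp: trit_of_def)

lemma ternary_digits_value:
  "(\<Sum>r<length (ternary_digits n). 3 ^ r * trit_val (ternary_digits n ! r)) = n"
proof (induction n rule: ternary_digits.induct)
  case (1 n)
  show ?case
  proof (cases "n = 0")
    case False
    have "(\<Sum>r<length (ternary_digits n). 3 ^ r * trit_val (ternary_digits n ! r))
        = trit_val (trit_of n)
          + 3 * (\<Sum>r<length (ternary_digits (n div 3)).
                   3 ^ r * trit_val (ternary_digits (n div 3) ! r))"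
      using False
      by (simp add: ternary_digits.simps[of n] sum.lessThan_Suc_shift sum_distrib_left mult.assoc
               del: sum.lessThan_Suc)
    also have "\<dots> = n mod 3 + 3 * (n div 3)"
      using 1[OF False] by (simp add: trit_val_trit_of)
    finally show ?thesis by simp
  qed (simp add: ternary_digits.simps)
qed

lemma ternary_digits_last: "n > 0 \<Longrightarrow> ternary_digits n \<noteq> [] \<and> last (ternary_digits n) \<noteq> Zero"
proof (induction n rule: ternary_digits.induct)
  case (1 n)
  show ?case
  proof (cases "n div 3 = 0")
    case True
    then have "n mod 3 = n" by (simp add: div_eq_0_iff)
    with True 1 show ?thesis
      by (auto simp: ternary_digits.simps[of n] ternary_digits.simps[of 0] trit_of_def)
  next
    case False
    with 1 show ?thesis by (simp add: ternary_digits.simps[of n])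
  qed
qed

datatype bottom_state = Digit trit | Empty

datatype top_state = OddNormal | OddSpecial | Even | UnknownParity

text \<open>Both layers are indexed by row (from top to bottom) and column (from right to left, so that
  column \<open>j + 1\<close> is the left neighbour of column \<open>j\<close>).\<close>

record config =
  bottom_layer :: "nat \<Rightarrow> int \<Rightarrow> bottom_state"
  top_layer :: "nat \<Rightarrow> int \<Rightarrow> top_state"

definition ca1_init :: "int \<Rightarrow> nat \<Rightarrow> config" where
  "ca1_init c0 n =
     \<lparr> bottom_layer = (\<lambda>i j.
         if i = 0 \<and> c0 \<le> j \<and> j < c0 + int (length (ternary_digits n))
         then Digit (ternary_digits n ! nat (j - c0)) else Empty),
       top_layer = (\<lambda>i j. UnknownParity) \<rparr>"

definition parity_state :: "nat \<Rightarrow> top_state" where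
  "parity_state k = (if even k then Even else OddNormal)"

text \<open>Arguments: the left neighbour in the top layer, and the cell below in the bottom layer.\<close>

definition top_rule :: "top_state \<Rightarrow> bottom_state \<Rightarrow> top_state" where
  "top_rule l d =
     (case (l, d) of
        (UnknownParity, Digit x) \<Rightarrow> parity_state (trit_val x)
      | (Even, Digit x) \<Rightarrow> parity_state (0 + trit_val x)
      | (OddNormal, Digit x) \<Rightarrow> parity_state (1 + trit_val x)
      | (OddNormal, Empty) \<Rightarrow> OddSpecial
      | _ \<Rightarrow> UnknownParity)"

text \<open>Arguments, for a cell in row \<open>i\<close> and column \<open>j\<close>: the bottom-layer states at \<open>(i - 1, j)\<close>,
  \<open>(i - 1, j - 1)\<close> and \<open>(i, j - 1)\<close>, then the top-layer states at \<open>(i - 1, j)\<close> and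
  \<open>(i - 1, j - 1)\<close>.  The digits picked by \<open>THE\<close> exist uniquely by the lemmas below.\<close>

definition bottom_rule ::
  "bottom_state \<Rightarrow> bottom_state \<Rightarrow> bottom_state \<Rightarrow> top_state \<Rightarrow> top_state \<Rightarrow> bottom_state" where
  "bottom_rule a b c p q =
     (case (a, b, c) of
        (Digit a', Digit b', Digit c') \<Rightarrow>
          if p \<in> {Even, OddNormal} \<and> q \<in> {Even, OddNormal} \<and>
             (\<exists>e\<in>{0, 1}. [2 * trit_val c' + e = trit_val b'] (mod 3))
          then Digit (THE x. \<exists>e\<in>{0, 1}. [2 * trit_val c' + e = trit_val b'] (mod 3) \<and>
                 [2 * (3 * trit_val x + trit_val c') + e = 3 * trit_val a' + trit_val b'] (mod 9))
          else Empty
      | (Digit a', Empty, Empty) \<Rightarrow>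
          if p = Even \<and> q = UnknownParity
          then Digit (THE x. [2 * trit_val x = trit_val a'] (mod 3))
          else Empty
      | (Empty, Empty, Empty) \<Rightarrow>
          if p = OddSpecial \<and> q = UnknownParity then Digit Two else Empty
      | (Digit a', Empty, Digit c') \<Rightarrow>
          if c' = Two \<and> p = OddNormal \<and> q = OddSpecial
          then Digit (THE x. [2 * (3 * trit_val x + 2) = 3 * trit_val a' + 1] (mod 9))
          else Empty
      | _ \<Rightarrow> Empty)"

lemma ex1_trit: "(\<exists>!x. P x) \<longleftrightarrow>
    (P Zero \<and> \<not> P One \<and> \<not> P Two) \<or> (\<not> P Zero \<and> P One \<and> \<not> P Two) \<or>
    (\<not> P Zero \<and> \<not> P One \<and> P Two)"
  by (metis trit.exhaust trit.distinct(1,3,5))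

lemma bottom_rule_interior_ex1:
  assumes "\<exists>e\<in>{0, 1}. [2 * trit_val c + e = trit_val b] (mod 3)"
  shows "\<exists>!x. \<exists>e\<in>{0, 1}. [2 * trit_val c + e = trit_val b] (mod 3) \<and>
           [2 * (3 * trit_val x + trit_val c) + e = 3 * trit_val a + trit_val b] (mod 9)"
  using assms by (cases a; cases b; cases c) (simp_all add: ex1_trit cong_def)

lemma bottom_rule_even_end_ex1: "\<exists>!x. [2 * trit_val x = trit_val a] (mod 3)"
  by (cases a) (simp_all add: ex1_trit cong_def)

lemma bottom_rule_odd_end_ex1:
  "\<exists>!x. [2 * (3 * trit_val x + 2) = 3 * trit_val a + 1] (mod 9)"
  by (cases a) (simp_all add: ex1_trit cong_def)

definition ca1_step :: "config \<Rightarrow> config" where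
  "ca1_step s =
     \<lparr> bottom_layer = (\<lambda>i j.
         if i = 0 then bottom_layer s 0 j
         else bottom_rule (bottom_layer s (i - 1) j) (bottom_layer s (i - 1) (j - 1))
                (bottom_layer s i (j - 1)) (top_layer s (i - 1) j) (top_layer s (i - 1) (j - 1))),
       top_layer = (\<lambda>i j. top_rule (top_layer s i (j + 1)) (bottom_layer s i j)) \<rparr>"

text \<open>\<open>xs\<close> lists the states of the non-empty bottom-layer cells of row \<open>i\<close> from left to right, that
  is, by decreasing column.  In particular there are only finitely many such cells.\<close>

definition row_reads :: "config \<Rightarrow> nat \<Rightarrow> bottom_state list \<Rightarrow> bool" where
  "row_reads s i xs \<longleftrightarrow>
     (\<exists>js. sorted_wrt (>) js \<and> set js = {j. bottom_layer s i j \<noteq> Empty} \<and>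
           xs = map (bottom_layer s i) js)"

end

theory Submission
  imports Defs Complex_Main
begin

text \<open>
  Say that a row \<^emph>\<open>displays\<close> \<open>x\<close> if its bottom layer holds the ternary digits of \<open>x\<close>, possibly with
  leading zeros, in the columns \<open>c, \<dots>, c + L - 1\<close>, while its top layer holds in column \<open>c + r\<close> the
  parity of \<open>x div 3 ^ r\<close> and, if \<open>x\<close> is odd, the mark \<open>OddSpecial\<close> just to the right of the last
  digit.  The theorem combines two facts: displays are consistent with the rules, and the automaton
  is attracted to them.

  \<^emph>\<open>Consistency.\<close>  Since \<open>3\<close> is odd, \<open>x div 3 ^ r\<close> has the parity of the sum of the digits from
  position \<open>r\<close> upwards; this is what the top layer accumulates from left to right
  (\<open>top_rule_row\<close>).  The bottom layer performs a division by two that starts at the \<^emph>\<open>least\<close>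
  significant digit.  Put \<open>y = T1 x\<close>.  For even \<open>x\<close> we have \<open>2 * y = x\<close>; for odd \<open>x\<close> we have
  \<open>2 * y = 3 * x + 1\<close>, and the digits of \<open>3 * x + 1\<close> are those of \<open>x\<close> followed by a \<open>1\<close>, which is
  why \<open>OddSpecial\<close> opens one new column on the right.  In both cases the next digit of \<open>y\<close> can be
  found from the carry \<open>\<epsilon>\<close> of the doubling: above any position, the doubled number is
  \<open>2 * Y + \<epsilon>\<close> with \<open>Y\<close> the part of \<open>y\<close> above that position, and modulo \<open>9\<close> this equation
  determines the second lowest digit of \<open>Y\<close> from the lowest one (\<open>bottom_rule_doubling\<close>).  So below a
  display of \<open>x\<close>, a display of \<open>T1 x\<close> satisfies the bottom rules (\<open>bottom_rule_row\<close>).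

  \<^emph>\<open>Attraction.\<close>  A cell may hold wrong values for a while, but the dependencies between cells have
  no cycles.  Once a row has settled, the cells below it that lie outside a finite window are forced
  one step later, whatever their neighbours are; inside the window, the bottom layer then settles
  cell by cell from right to left (\<open>bottom_row_settles\<close>), and afterwards the top layer from left to
  right (\<open>top_row_settles\<close>).  Thus every row is eventually constant, and finitely many rows are so
  at a common time.
\<close>

section \<open>Rows displaying a number\<close>

definition row_bottom :: "int \<Rightarrow> nat \<Rightarrow> nat \<Rightarrow> int \<Rightarrow> bottom_state" where
  "row_bottom c L x j =
     (if c \<le> j \<and> j < c + int L then Digit (trit_of (x div 3 ^ nat (j - c))) else Empty)"

definition row_top :: "int \<Rightarrow> nat \<Rightarrow> nat \<Rightarrow> int \<Rightarrow> top_state" where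
  "row_top c L x j =
     (if c \<le> j \<and> j < c + int L then parity_state (x div 3 ^ nat (j - c))
      else if j = c - 1 \<and> odd x then OddSpecial else UnknownParity)"

lemma digits_eq_ternary_digits:
  assumes "x < 3 ^ L"
  shows "\<exists>z. map (\<lambda>r. trit_of (x div 3 ^ r)) [0..<L] = ternary_digits x @ replicate z Zero"
  using assms
proof (induction L arbitrary: x)
  case 0
  then show ?case by (simp add: ternary_digits.simps)
next
  case (Suc L)
  have "x div 3 < 3 ^ L" using Suc.prems by (simp add: less_mult_imp_div_less mult.commute)
  from Suc.IH[OF this] obtain z where
    z: "map (\<lambda>r. trit_of (x div 3 div 3 ^ r)) [0..<L] = ternary_digits (x div 3) @ replicate z Zero"
    by blast
  have "map (\<lambda>r. trit_of (x div 3 ^ r)) [0..<Suc L]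
      = trit_of x # map (\<lambda>r. trit_of (x div 3 div 3 ^ r)) [0..<L]"
    by (simp add: map_upt_Suc div_mult2_eq del: upt_Suc)
  also have "\<dots> = trit_of x # ternary_digits (x div 3) @ replicate z Zero"
    using z by simp
  finally have *: "map (\<lambda>r. trit_of (x div 3 ^ r)) [0..<Suc L] = \<dots>" .
  show ?case
  proof (cases "x = 0")
    case True
    then have "trit_of x # ternary_digits (x div 3) @ replicate z Zero
        = ternary_digits x @ replicate (Suc z) Zero"
      by (simp add: ternary_digits.simps trit_of_def)
    with * show ?thesis by metis
  next
    case False
    then have "trit_of x # ternary_digits (x div 3) @ replicate z Zero
        = ternary_digits x @ replicate z Zero"
      by (simp add: ternary_digits.simps[of x])
    with * show ?thesis by metis
  qed
qed

lemma nth_ternary_digits: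
  "r < length (ternary_digits x) \<Longrightarrow> ternary_digits x ! r = trit_of (x div 3 ^ r)"
proof (induction x arbitrary: r rule: ternary_digits.induct)
  case (1 x)
  then have "x \<noteq> 0"
    by (intro notI) (simp add: ternary_digits.simps[of 0])
  with 1 show ?case
    by (cases r) (simp_all add: ternary_digits.simps[of x] div_mult2_eq)
qed

lemma less_power_length_ternary_digits: "x < 3 ^ length (ternary_digits x)"
proof (induction x rule: ternary_digits.induct)
  case (1 x)
  then show ?case
    by (cases "x = 0") (auto simp: ternary_digits.simps[of x])
qed

lemma row_reads_row_bottom:
  assumes "bottom_layer s i = row_bottom c L x" and "x < 3 ^ L"
  shows "\<exists>z. row_reads s i (map Digit (replicate z Zero @ rev (ternary_digits x)))"
proof -
  obtain z where z: "map (\<lambda>r. trit_of (x div 3 ^ r)) [0..<L] = ternary_digits x @ replicate z Zero"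
    using digits_eq_ternary_digits[OF assms(2)] by blast
  let ?js = "rev (map (\<lambda>r. c + int r) [0..<L])"
  have "sorted_wrt (>) ?js"
    by (simp add: sorted_wrt_rev sorted_wrt_map)
  moreover have "j \<in> set ?js \<longleftrightarrow> row_bottom c L x j \<noteq> Empty" for j
  proof -
    have "j \<in> (\<lambda>r. c + int r) ` {0..<L}" if "c \<le> j" "j < c + int L"
      using that by (intro image_eqI[of _ _ "nat (j - c)"]) auto
    then show ?thesis by (auto simp: row_bottom_def)
  qed
  moreover have "map (row_bottom c L x) ?js
      = map Digit (rev (map (\<lambda>r. trit_of (x div 3 ^ r)) [0..<L]))"
    by (simp add: rev_map row_bottom_def)
  ultimately show ?thesis
    unfolding row_reads_def assms(1) z by (intro exI[of _ z] exI[of _ ?js]) auto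
qed

section \<open>The rules are consistent with displays\<close>

text \<open>As \<open>3\<close> is odd, \<open>X = 3 * (X div 3) + X mod 3\<close> has the parity of \<open>X div 3 + X mod 3\<close>.\<close>

lemma top_rule_parity:
  "top_rule (parity_state (X div 3)) (Digit (trit_of X)) = parity_state X"
proof -
  have "even X \<longleftrightarrow> even (X div 3 + X mod 3)"
    by presburger
  then show ?thesis
    by (cases "even (X div 3)") (auto simp: top_rule_def parity_state_def trit_val_trit_of)
qed

lemma top_rule_row:
  assumes "x < 3 ^ L"
  shows "top_rule (row_top c L x (j + 1)) (row_bottom c L x j) = row_top c L x j"
proof -
  consider "j < c - 1" | "j = c - 1" | "c \<le> j" "j + 1 < c + int L" | "c \<le> j" "j + 1 = c + int L"
    | "c + int L \<le> j"
    by linarith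
  then show ?thesis
  proof cases
    case 1
    then show ?thesis
      by (simp add: row_top_def row_bottom_def top_rule_def split: top_state.splits)
  next
    case 2
    then show ?thesis using assms
      by (cases L) (auto simp: row_top_def row_bottom_def top_rule_def parity_state_def)
  next
    case 3
    then have "nat (j + 1 - c) = Suc (nat (j - c))" by linarith
    with 3 show ?thesis
      using top_rule_parity[of "x div 3 ^ nat (j - c)"]
      by (simp add: row_top_def row_bottom_def div_mult2_eq[symmetric] mult.commute)
  next
    case 4
    \<comment> \<open>The first digit finds \<open>UnknownParity\<close> on its left, which acts like the parity of
      \<open>x div 3 ^ L = 0\<close>.\<close>
    let ?X = "x div 3 ^ nat (j - c)"
    have "L = Suc (nat (j - c))" using 4 by linarith
    with assms have "?X < 3" by (simp add: less_mult_imp_div_less mult.commute)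
    with 4 show ?thesis
      by (simp add: row_top_def row_bottom_def top_rule_def trit_val_trit_of)
  next
    case 5
    then show ?thesis
      by (simp add: row_top_def row_bottom_def top_rule_def)
  qed
qed

lemma two_trits: "3 * trit_val (trit_of (X div 3)) + trit_val (trit_of X) = X mod 9"
  using mod_mult2_eq[of X 3 3] by (simp add: trit_val_trit_of)

text \<open>Read \<open>W\<close> and \<open>Y\<close> as what remains of a number and of its half after dropping equally many low
  digits, and \<open>e\<close> as the carry of the doubling into the remaining digits.\<close>

lemma bottom_rule_doubling:
  assumes "W = 2 * Y + e" and "e < 2"
    and "p \<in> {Even, OddNormal}" and "q \<in> {Even, OddNormal}"
  shows "bottom_rule (Digit (trit_of (W div 3))) (Digit (trit_of W)) (Digit (trit_of Y)) p q
       = Digit (trit_of (Y div 3))"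
proof -
  let ?P = "\<lambda>x. \<exists>e\<in>{0, 1}. [2 * trit_val (trit_of Y) + e = trit_val (trit_of W)] (mod 3) \<and>
     [2 * (3 * trit_val x + trit_val (trit_of Y)) + e
       = 3 * trit_val (trit_of (W div 3)) + trit_val (trit_of W)] (mod 9)"
  have e: "e \<in> {0, 1}" using assms(2) by auto
  have c3: "[2 * trit_val (trit_of Y) + e = trit_val (trit_of W)] (mod 3)"
    unfolding trit_val_trit_of assms(1) cong_def
    by (metis mod_add_left_eq mod_mod_trivial mod_mult_right_eq)
  have "[2 * (Y mod 9) + e = W mod 9] (mod 9)"
    unfolding assms(1) cong_def
    by (metis mod_add_left_eq mod_mod_trivial mod_mult_right_eq)
  with c3 e have "?P (trit_of (Y div 3))"
    unfolding two_trits by blast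
  moreover have ex: "\<exists>e\<in>{0, 1}. [2 * trit_val (trit_of Y) + e = trit_val (trit_of W)] (mod 3)"
    using c3 e by blast
  ultimately have "(THE x. ?P x) = trit_of (Y div 3)"
    using bottom_rule_interior_ex1[OF ex] by (intro the1_equality) auto
  with ex assms(3,4) show ?thesis
    unfolding bottom_rule_def by simp
qed

lemma bottom_rule_even_end:
  "bottom_rule (Digit (trit_of (2 * y))) Empty Empty Even UnknownParity = Digit (trit_of y)"
proof -
  have "[2 * trit_val (trit_of y) = trit_val (trit_of (2 * y))] (mod 3)"
    unfolding trit_val_trit_of cong_def by (simp add: mod_simps)
  then have "(THE x. [2 * trit_val x = trit_val (trit_of (2 * y))] (mod 3)) = trit_of y"
    using bottom_rule_even_end_ex1 by (intro the1_equality) auto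
  then show ?thesis by (simp add: bottom_rule_def)
qed

text \<open>Here the empty cell next to the last digit of \<open>x\<close> stands for the appended \<open>1\<close> of \<open>3 * x + 1\<close>, and
  \<open>Two\<close> is the last digit of \<open>y\<close>, as \<open>2 * 2\<close> is \<open>1\<close> modulo \<open>3\<close>.\<close>

lemma bottom_rule_odd_end:
  assumes "2 * y = 3 * x + 1"
  shows "bottom_rule (Digit (trit_of x)) Empty (Digit Two) OddNormal OddSpecial
       = Digit (trit_of (y div 3))"
proof -
  have "y mod 3 = 2" using assms by presburger
  then have "3 * trit_val (trit_of (y div 3)) + 2 = y mod 9"
    using two_trits[of y] by (simp add: trit_val_trit_of)
  then have "2 * (3 * trit_val (trit_of (y div 3)) + 2) mod 9 = (3 * x + 1) mod 9"
    using assms by (simp add: mod_simps)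
  also have "3 * x + 1 = 3 * (x mod 3) + 1 + 9 * (x div 3)"
    by presburger
  also have "\<dots> mod 9 = (3 * trit_val (trit_of x) + 1) mod 9"
    unfolding trit_val_trit_of by (rule mod_mult_self2)
  finally have "[2 * (3 * trit_val (trit_of (y div 3)) + 2) = 3 * trit_val (trit_of x) + 1] (mod 9)"
    unfolding cong_def .
  then have "(THE z. [2 * (3 * trit_val z + 2) = 3 * trit_val (trit_of x) + 1] (mod 9))
      = trit_of (y div 3)"
    using bottom_rule_odd_end_ex1 by (intro the1_equality) auto
  then show ?thesis by (simp add: bottom_rule_def)
qed

text \<open>Call the columns \<open>c - 1, \<dots>, c + L - 1\<close> the window of a display.  Outside it the rule ignores the
  state \<open>d\<close> of the right neighbour in the same row, so that the settling of the next row can start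
  there, whatever that row contains.\<close>

lemma bottom_rule_outside_row:
  assumes "j < c - 1 \<or> c + int L \<le> j"
  shows "bottom_rule (row_bottom c L x j) (row_bottom c L x (j - 1)) d
           (row_top c L x j) (row_top c L x (j - 1)) = Empty"
proof -
  have "row_bottom c L x j = Empty" "row_top c L x j = UnknownParity"
    using assms by (auto simp: row_bottom_def row_top_def)
  then show ?thesis
    by (cases d; cases "row_bottom c L x (j - 1)") (simp_all add: bottom_rule_def)
qed

lemma halving_carry:
  fixes w y m :: nat
  assumes "2 * y = w" and "m > 0"
  obtains e where "w div m = 2 * (y div m) + e" and "e < 2"
proof
  have "y = y mod m + y div m * m" by simp
  then have "w = 2 * (y mod m) + 2 * (y div m) * m"
    using assms(1) by (metis distrib_left mult.assoc)
  then show "w div m = 2 * (y div m) + 2 * (y mod m) div m"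
    using assms(2) by (metis div_mult_self1 not_gr_zero)
  show "2 * (y mod m) div m < 2"
    using assms(2) by (simp add: less_mult_imp_div_less)
qed

text \<open>For odd \<open>x\<close> the digit \<open>1\<close> appended to \<open>x\<close> in \<open>3 * x + 1\<close> costs one more column on the right.  The
  left end stays put: \<open>T1 x\<close> needs no more digits than \<open>x\<close> or \<open>3 * x + 1\<close>, but may get a leading zero.\<close>

lemma bottom_rule_row:
  fixes x L :: nat and c :: int
  assumes "x < 3 ^ L"
  defines "c' \<equiv> c - int (x mod 2)" and "L' \<equiv> L + x mod 2"
  shows "bottom_rule (row_bottom c L x j) (row_bottom c L x (j - 1)) (row_bottom c' L' (T1 x) (j - 1))
           (row_top c L x j) (row_top c L x (j - 1)) = row_bottom c' L' (T1 x) j"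
proof -
  let ?y = "T1 x"
  have parity: "parity_state k \<in> {Even, OddNormal}" for k by (simp add: parity_state_def)
  consider "j < c - 1 \<or> c + int L \<le> j" | "j = c - 1" | "j = c" "L > 0"
    | "c < j" "j < c + int L"
    by linarith
  then show ?thesis
  proof cases
    case 1
    then have "row_bottom c' L' (T1 x) j = Empty"
      by (auto simp: row_bottom_def c'_def L'_def)
    then show ?thesis using bottom_rule_outside_row[OF 1] by simp
  next
    case 2
    show ?thesis
    proof (cases "even x")
      case True
      with 2 show ?thesis
        by (simp add: row_bottom_def row_top_def bottom_rule_def c'_def L'_def even_iff_mod_2_eq_zero)
    next
      case False
      then have "2 * ?y = 3 * x + 1" by (simp add: T1_def)
      then have "?y mod 3 = 2" by presburger
      then have "trit_of ?y = Two" by (simp add: trit_of_def)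
      with False 2 show ?thesis
        by (simp add: row_bottom_def row_top_def bottom_rule_def c'_def L'_def
            odd_iff_mod_2_eq_one)
    qed
  next
    case 3
    show ?thesis
    proof (cases "even x")
      case True
      then have "2 * ?y = x" by (simp add: T1_def)
      with True 3 show ?thesis
        using bottom_rule_even_end[of ?y]
        by (simp add: row_bottom_def row_top_def c'_def L'_def parity_state_def
            even_iff_mod_2_eq_zero)
    next
      case False
      then have y: "2 * ?y = 3 * x + 1" by (simp add: T1_def)
      then have "?y mod 3 = 2" by presburger
      then have "trit_of ?y = Two" by (simp add: trit_of_def)
      moreover have "x mod 2 = 1" using False by (simp add: odd_iff_mod_2_eq_one)
      ultimately show ?thesis
        using False 3 bottom_rule_odd_end[OF y]
        by (simp add: row_bottom_def row_top_def c'_def L'_def parity_state_def)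
    qed
  next
    case 4
    define r where "r = nat (j - 1 - c)"
    have j: "j = c + int (Suc r)" "r < L" "Suc r < L" using 4 by (simp_all add: r_def)
    \<comment> \<open>Drop the digits below column \<open>j - 1\<close>; for odd \<open>x\<close> this includes the appended digit \<open>1\<close> of
      \<open>3 * x + 1\<close>.\<close>
    obtain e where e: "x div 3 ^ r = 2 * (?y div 3 ^ (r + x mod 2)) + e" "e < 2"
    proof (cases "even x")
      case True
      then have "2 * ?y = x" by (simp add: T1_def)
      then show ?thesis
        using that True halving_carry[of ?y x "3 ^ r"] by (auto simp: even_iff_mod_2_eq_zero)
    next
      case False
      then have "2 * ?y = 3 * x + 1" by (simp add: T1_def)
      moreover have "(3 * x + 1) div 3 = x" by simp
      then have "(3 * x + 1) div 3 ^ Suc r = x div 3 ^ r"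
        by (metis div_mult2_eq power_Suc)
      ultimately show ?thesis
        using that False halving_carry[of ?y "3 * x + 1" "3 ^ Suc r"]
        by (auto simp: odd_iff_mod_2_eq_one)
    qed
    have "row_bottom c L x j = Digit (trit_of (x div 3 ^ r div 3))"
      "row_bottom c L x (j - 1) = Digit (trit_of (x div 3 ^ r))"
      "row_top c L x j \<in> {Even, OddNormal}" "row_top c L x (j - 1) \<in> {Even, OddNormal}"
      using j parity
      by (simp_all add: row_bottom_def row_top_def nat_add_distrib div_mult2_eq[symmetric]
          mult.commute)
    moreover have "nat (j - c') = Suc (r + x mod 2)" "nat (j - 1 - c') = r + x mod 2"
      using j by (simp_all add: c'_def)
    then have "row_bottom c' L' ?y j = Digit (trit_of (?y div 3 ^ (r + x mod 2) div 3))"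
      "row_bottom c' L' ?y (j - 1) = Digit (trit_of (?y div 3 ^ (r + x mod 2)))"
      using j
      by (simp_all add: row_bottom_def c'_def L'_def div_mult2_eq[symmetric] mult.commute)
    ultimately show ?thesis
      using bottom_rule_doubling[OF e] by simp
  qed
qed

lemma T1_less_power:
  assumes "x < 3 ^ L"
  shows "T1 x < 3 ^ (L + x mod 2)"
proof (cases "even x")
  case True
  then have "2 * T1 x = x" by (simp add: T1_def)
  with True assms show ?thesis by simp
next
  case False
  then have "2 * T1 x = 3 * x + 1" by (simp add: T1_def)
  moreover have "x mod 2 = 1" using False by (simp add: odd_iff_mod_2_eq_one)
  ultimately show ?thesis using assms by simp
qed

section \<open>Rows settle\<close>

lemma ca1_step_bottom_Suc:
  "bottom_layer ((ca1_step ^^ Suc t) s) (Suc i) j =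
     bottom_rule (bottom_layer ((ca1_step ^^ t) s) i j) (bottom_layer ((ca1_step ^^ t) s) i (j - 1))
       (bottom_layer ((ca1_step ^^ t) s) (Suc i) (j - 1))
       (top_layer ((ca1_step ^^ t) s) i j) (top_layer ((ca1_step ^^ t) s) i (j - 1))"
  by (simp add: ca1_step_def)

lemma ca1_step_top_Suc:
  "top_layer ((ca1_step ^^ Suc t) s) i j =
     top_rule (top_layer ((ca1_step ^^ t) s) i (j + 1)) (bottom_layer ((ca1_step ^^ t) s) i j)"
  by (simp add: ca1_step_def)

lemma bottom_row_0_constant: "bottom_layer ((ca1_step ^^ t) s) 0 = bottom_layer s 0"
  by (induction t) (simp_all add: ca1_step_def)

lemma eventually_SucI: "eventually (\<lambda>t. P (Suc t)) sequentially \<Longrightarrow> eventually P sequentially"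
  by (rule eventually_sequentially_Suc[THEN iffD1])

lemma top_rule_Empty_neq: "top_rule l Empty \<noteq> OddNormal"
  by (cases l) (simp_all add: top_rule_def)

lemma top_rule_Empty: "l \<noteq> OddNormal \<Longrightarrow> top_rule l Empty = UnknownParity"
  by (cases l) (simp_all add: top_rule_def)

text \<open>In the top layer the state of a cell outside the window depends on the one to its left, but only
  through its being \<open>OddNormal\<close>, and one step after the bottom layer has settled no cell over
  an empty one is \<open>OddNormal\<close>.  So two steps suffice there.\<close>

lemma top_row_settles:
  fixes s :: config
  defines "S \<equiv> \<lambda>t. (ca1_step ^^ t) s"
  assumes bottom: "\<forall>\<^sub>F t in sequentially. bottom_layer (S t) i = row_bottom c L x"
    and x: "x < 3 ^ L"
  shows "\<forall>\<^sub>F t in sequentially. top_layer (S t) i = row_top c L x"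
proof -
  from bottom have "\<forall>\<^sub>F t in sequentially. \<forall>j. row_bottom c L x j = Empty \<longrightarrow>
      top_layer (S (Suc t)) i j \<noteq> OddNormal"
    unfolding S_def ca1_step_top_Suc by eventually_elim (simp add: top_rule_Empty_neq)
  then have "\<forall>\<^sub>F t in sequentially. \<forall>j. row_bottom c L x j = Empty \<longrightarrow>
      top_layer (S t) i j \<noteq> OddNormal"
    by (rule eventually_SucI)
  with bottom have "\<forall>\<^sub>F t in sequentially. \<forall>j. row_bottom c L x j = Empty \<and>
      row_bottom c L x (j + 1) = Empty \<longrightarrow> top_layer (S (Suc t)) i j = UnknownParity"
    unfolding S_def ca1_step_top_Suc by eventually_elim (simp add: top_rule_Empty)
  then have "\<forall>\<^sub>F t in sequentially. \<forall>j. j < c - 1 \<or> c + int L \<le> j \<longrightarrow>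
      top_layer (S (Suc t)) i j = row_top c L x j"
    by eventually_elim (auto simp: row_bottom_def row_top_def)
  then have outside: "\<forall>\<^sub>F t in sequentially. \<forall>j. j < c - 1 \<or> c + int L \<le> j \<longrightarrow>
      top_layer (S t) i j = row_top c L x j"
    by (rule eventually_SucI)
  have inside: "\<forall>\<^sub>F t in sequentially. top_layer (S t) i (c + int L - int r)
      = row_top c L x (c + int L - int r)" for r
  proof (induction r)
    case 0
    from outside show ?case by eventually_elim auto
  next
    case (Suc r)
    let ?j = "c + int L - int (Suc r)"
    have j: "?j + 1 = c + int L - int r" by simp
    have "\<forall>\<^sub>F t in sequentially. top_layer (S (Suc t)) i ?j = row_top c L x ?j"
      using bottom Suc.IH
    proof eventually_elim
      case (elim t)
      then show ?case
        using top_rule_row[OF x, of c ?j] unfolding S_def ca1_step_top_Suc j by simp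
    qed
    then show ?case by (rule eventually_SucI)
  qed
  have "\<forall>\<^sub>F t in sequentially. \<forall>r\<in>{..Suc L}. top_layer (S t) i (c + int L - int r)
      = row_top c L x (c + int L - int r)"
    by (intro eventually_ball_finite ballI inside) simp
  with outside show ?thesis
  proof eventually_elim
    case (elim t)
    show ?case
    proof
      fix j
      show "top_layer (S t) i j = row_top c L x j"
        using elim(1)[rule_format, of j] elim(2)[rule_format, of "nat (c + int L - j)"]
        by (cases "j < c - 1 \<or> c + int L \<le> j") auto
    qed
  qed
qed

text \<open>A cell of row \<open>Suc i\<close> depends on its right neighbour and on the settled row above, so correct
  values spread to the left from the empty cells beyond the right end of the window.\<close>

lemma bottom_row_settles:
  fixes s :: config and x L :: nat and c :: int
  defines "S \<equiv> \<lambda>t. (ca1_step ^^ t) s" and "c' \<equiv> c - int (x mod 2)" and "L' \<equiv> L + x mod 2"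
  assumes bottom: "\<forall>\<^sub>F t in sequentially. bottom_layer (S t) i = row_bottom c L x"
    and x: "x < 3 ^ L"
  shows "\<forall>\<^sub>F t in sequentially. bottom_layer (S t) (Suc i) = row_bottom c' L' (T1 x)"
proof -
  have top: "\<forall>\<^sub>F t in sequentially. top_layer (S t) i = row_top c L x"
    using top_row_settles bottom x unfolding S_def by blast
  from bottom top have "\<forall>\<^sub>F t in sequentially. \<forall>j. j < c - 1 \<or> c + int L \<le> j \<longrightarrow>
      bottom_layer (S (Suc t)) (Suc i) j = row_bottom c' L' (T1 x) j"
  proof eventually_elim
    case (elim t)
    then have "bottom_layer (S (Suc t)) (Suc i) j = Empty"
      if "j < c - 1 \<or> c + int L \<le> j" for j
      using that unfolding S_def ca1_step_bottom_Suc by (simp add: bottom_rule_outside_row)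
    then show ?case by (auto simp: row_bottom_def c'_def L'_def)
  qed
  then have outside: "\<forall>\<^sub>F t in sequentially. \<forall>j. j < c - 1 \<or> c + int L \<le> j \<longrightarrow>
      bottom_layer (S t) (Suc i) j = row_bottom c' L' (T1 x) j"
    by (rule eventually_SucI)
  \<comment> \<open>Column \<open>c - 2\<close> is the first one to the right of the window.\<close>
  have inside: "\<forall>\<^sub>F t in sequentially. bottom_layer (S t) (Suc i) (c - 2 + int r)
      = row_bottom c' L' (T1 x) (c - 2 + int r)" for r
  proof (induction r)
    case 0
    from outside show ?case by eventually_elim auto
  next
    case (Suc r)
    let ?j = "c - 2 + int (Suc r)"
    have j: "?j - 1 = c - 2 + int r" by simp
    have "\<forall>\<^sub>F t in sequentially. bottom_layer (S (Suc t)) (Suc i) ?j = row_bottom c' L' (T1 x) ?j"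
      using bottom top Suc.IH
    proof eventually_elim
      case (elim t)
      then show ?case
        using bottom_rule_row[OF x, of c ?j] unfolding S_def ca1_step_bottom_Suc j c'_def L'_def
        by simp
    qed
    then show ?case by (rule eventually_SucI)
  qed
  have "\<forall>\<^sub>F t in sequentially. \<forall>r\<in>{..Suc L}. bottom_layer (S t) (Suc i) (c - 2 + int r)
      = row_bottom c' L' (T1 x) (c - 2 + int r)"
    by (intro eventually_ball_finite ballI inside) simp
  with outside show ?thesis
  proof eventually_elim
    case (elim t)
    show ?case
    proof
      fix j
      show "bottom_layer (S t) (Suc i) j = row_bottom c' L' (T1 x) j"
        using elim(1)[rule_format, of j] elim(2)[rule_format, of "nat (j - c + 2)"]
        by (cases "j < c - 1 \<or> c + int L \<le> j") auto
    qed
  qed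
qed

lemma ca1_row_settles:
  "\<exists>c L. (T1 ^^ k) n < 3 ^ L \<and> (\<forall>\<^sub>F t in sequentially.
     bottom_layer ((ca1_step ^^ t) (ca1_init c0 n)) k = row_bottom c L ((T1 ^^ k) n))"
proof (induction k)
  case 0
  have "bottom_layer (ca1_init c0 n) 0 = row_bottom c0 (length (ternary_digits n)) n"
    by (auto simp: ca1_init_def row_bottom_def fun_eq_iff nth_ternary_digits nat_less_iff)
  then show ?case
    using less_power_length_ternary_digits[of n]
    by (intro exI[of _ c0] exI[of _ "length (ternary_digits n)"])
      (simp add: bottom_row_0_constant)
next
  case (Suc k)
  then obtain c L where *: "(T1 ^^ k) n < 3 ^ L" "\<forall>\<^sub>F t in sequentially.
      bottom_layer ((ca1_step ^^ t) (ca1_init c0 n)) k = row_bottom c L ((T1 ^^ k) n)"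
    by blast
  from bottom_row_settles[OF *(2,1)] T1_less_power[OF *(1)] show ?case
    unfolding funpow.simps comp_def by (intro exI conjI)
qed

theorem theorem1:
  fixes n m :: nat and c0 :: int
  assumes "n > 0"
  shows "\<exists>t. \<forall>k\<le>m. \<exists>z.
           row_reads ((ca1_step ^^ t) (ca1_init c0 n)) k
             (map Digit (replicate z Zero @ rev (ternary_digits ((T1 ^^ k) n))))"
proof -
  have "\<forall>\<^sub>F t in sequentially. \<exists>z. row_reads ((ca1_step ^^ t) (ca1_init c0 n)) k
      (map Digit (replicate z Zero @ rev (ternary_digits ((T1 ^^ k) n))))" for k
  proof -
    from ca1_row_settles[of k n c0]
    obtain c L where less: "(T1 ^^ k) n < 3 ^ L" and settled: "\<forall>\<^sub>F t in sequentially.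
        bottom_layer ((ca1_step ^^ t) (ca1_init c0 n)) k = row_bottom c L ((T1 ^^ k) n)"
      by (elim exE conjE)
    from settled show ?thesis
      by (rule eventually_mono) (rule row_reads_row_bottom[OF _ less])
  qed
  then have "\<forall>\<^sub>F t in sequentially. \<forall>k\<in>{..m}. \<exists>z.
      row_reads ((ca1_step ^^ t) (ca1_init c0 n)) k
        (map Digit (replicate z Zero @ rev (ternary_digits ((T1 ^^ k) n))))"
    by (intro eventually_ball_finite ballI) simp_all
  then obtain t where "\<forall>k\<in>{..m}. \<exists>z.
      row_reads ((ca1_step ^^ t) (ca1_init c0 n)) k
        (map Digit (replicate z Zero @ rev (ternary_digits ((T1 ^^ k) n))))"
    using eventually_happens'[OF sequentially_bot] by blast
  then show ?thesis by auto
qed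

end
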